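(* Every formula of BR is equivalent over (finite) data words to a formula of the $\nu$-fragment.
   Context: Data words are finite sequences over $\Sigma\times\mathcal D$ ($\Sigma$ finite alphabet, $\mathcal D$ infinite); $i\sim j$ iff positions $i,j$ carry the same data value; the class successor/predecessor of $i$ is the nearest later/earlier position $j\sim i$. $\mu$-calculus: $\varphi::= x\mid A\mid\neg A\mid \mathsf M\varphi\mid\varphi\vee\varphi\mid\varphi\wedge\varphi\mid\mu x.\varphi\mid\nu x.\varphi$, with fixpoint variables $x$, atoms $A$: letters of $\Sigma$ and zeroary $\mathsf S,\mathsf P,\mathsf{first}^g,\mathsf{last}^g,\mathsf{first}^c,\mathsf{last}^c$; unary modalities $\mathsf M\in\{\mathtt X^g,\mathtt X^c,\mathtt Y^g,\mathtt Y^c\}$ evaluating the argument at the successor, class successor, predecessor, class predecessor respectively (false if nonexistent). Letters hold where they label the position; $\mathsf{first}^g$/$\mathsf{last}^g$ at the first/last position; $\mathsf{first}^c$/$\mathsf{last}^c$ where there is no class predecessor/successor; $\mathsf S$ at $i$ iff $i$ is not last and $i+1$ is the class successor of $i$; $\mathsf P$ at $i$ iff $i\ne1$ and $i-1$ is the class predecessor of $i$; $\mu,\nu$ least/greatest fixpoints. Equivalence: same denotation on every data word. The $\nu$-fragment: formulas without $\mu$. For a set $M$ of unary modalities, $\mathsf{Formulas}(M)$ is the set of formulas whose unary modalities all lie in $M$. For a set $\Psi$ of formulas: $\mathsf{Comp}^0(\Psi)=\emptyset$; $\mathsf{Comp}^{i+1}(\Psi)=\{\psi(\varphi_1,\dots,\varphi_n)\mid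 \psi(x_1,\dots,x_n)\in\Psi,\ \varphi_j\in\mathsf{Comp}^i(\Psi)\}$ ($\psi$ with free variables among $x_1,\dots,x_n$, capture-avoiding substitution); $\mathsf{Comp}(\Psi)=\bigcup_i\mathsf{Comp}^i(\Psi)$. BR $=\mathsf{Comp}(\mathsf{Formulas}(\{\mathtt X^c,\mathtt X^g\})\cup\mathsf{Formulas}(\{\mathtt Y^c,\mathtt Y^g\}))$. *)

theory Defs
  imports Main
begin

text \<open>Positions of a data word \<open>w\<close> are numbered \<open>0, \<dots>, length w - 1\<close>.\<close>

type_synonym ('a, 'd) data_word = "('a \<times> 'd) list"

definition positions :: "('a, 'd) data_word \<Rightarrow> nat set" where
  "positions w = {i. i < length w}"

definition same_class :: "('a, 'd) data_word \<Rightarrow> nat \<Rightarrow> nat \<Rightarrow> bool" where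
  "same_class w i j \<longleftrightarrow>
     i \<in> positions w \<and> j \<in> positions w \<and> snd (w ! i) = snd (w ! j)"

definition is_succ :: "('a, 'd) data_word \<Rightarrow> nat \<Rightarrow> nat \<Rightarrow> bool" where
  "is_succ w i j \<longleftrightarrow> i \<in> positions w \<and> j \<in> positions w \<and> j = i + 1"

definition is_pred :: "('a, 'd) data_word \<Rightarrow> nat \<Rightarrow> nat \<Rightarrow> bool" where
  "is_pred w i j \<longleftrightarrow> i \<in> positions w \<and> j \<in> positions w \<and> i = j + 1"

definition is_class_succ :: "('a, 'd) data_word \<Rightarrow> nat \<Rightarrow> nat \<Rightarrow> bool" where
  "is_class_succ w i j \<longleftrightarrow>
     i < j \<and> same_class w i j \<and> (\<forall>k. i < k \<and> k < j \<longrightarrow> \<not> same_class w i k)"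

definition is_class_pred :: "('a, 'd) data_word \<Rightarrow> nat \<Rightarrow> nat \<Rightarrow> bool" where
  "is_class_pred w i j \<longleftrightarrow>
     j < i \<and> same_class w i j \<and> (\<forall>k. j < k \<and> k < i \<longrightarrow> \<not> same_class w i k)"

datatype 'a atom =
    Letter 'a
  | S | P
  | First_g | Last_g
  | First_c | Last_c

datatype modality = X_g | X_c | Y_g | Y_c

datatype 'a formula =
    Var nat
  | Atom "'a atom"
  | NegAtom "'a atom"
  | Mod modality "'a formula"
  | Or "'a formula" "'a formula"
  | And "'a formula" "'a formula"
  | Mu nat "'a formula"
  | Nu nat "'a formula"

primrec atom_holds :: "('a, 'd) data_word \<Rightarrow> 'a atom \<Rightarrow> nat \<Rightarrow> bool" where
  "atom_holds w (Letter a) i \<longleftrightarrow> fst (w ! i) = a"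
| "atom_holds w S i \<longleftrightarrow> i + 1 < length w \<and> is_class_succ w i (i + 1)"
| "atom_holds w P i \<longleftrightarrow> i \<noteq> 0 \<and> is_class_pred w i (i - 1)"
| "atom_holds w First_g i \<longleftrightarrow> i = 0"
| "atom_holds w Last_g i \<longleftrightarrow> i + 1 = length w"
| "atom_holds w First_c i \<longleftrightarrow> \<not> (\<exists>j. is_class_pred w i j)"
| "atom_holds w Last_c i \<longleftrightarrow> \<not> (\<exists>j. is_class_succ w i j)"

primrec mod_step :: "modality \<Rightarrow> ('a, 'd) data_word \<Rightarrow> nat \<Rightarrow> nat \<Rightarrow> bool" where
  "mod_step X_g = is_succ"
| "mod_step X_c = is_class_succ"
| "mod_step Y_g = is_pred"
| "mod_step Y_c = is_class_pred"

text \<open>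
  The intersection with \<open>positions w\<close> in the variable case makes every denotation a set of
  positions, for arbitrary valuations \<open>\<rho>\<close>. Hence \<open>lfp\<close> and \<open>gfp\<close>, taken in the lattice
  of all sets of naturals, agree with those in the lattice of sets of positions.
\<close>

primrec sem :: "('a, 'd) data_word \<Rightarrow> (nat \<Rightarrow> nat set) \<Rightarrow> 'a formula \<Rightarrow> nat set" where
  "sem w \<rho> (Var x) = \<rho> x \<inter> positions w"
| "sem w \<rho> (Atom A) = {i \<in> positions w. atom_holds w A i}"
| "sem w \<rho> (NegAtom A) = {i \<in> positions w. \<not> atom_holds w A i}"
| "sem w \<rho> (Mod m \<phi>) = {i \<in> positions w. \<exists>j. mod_step m w i j \<and> j \<in> sem w \<rho> \<phi>}"
| "sem w \<rho> (Or \<phi> \<psi>) = sem w \<rho> \<phi> \<union> sem w \<rho> \<psi>"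
| "sem w \<rho> (And \<phi> \<psi>) = sem w \<rho> \<phi> \<inter> sem w \<rho> \<psi>"
| "sem w \<rho> (Mu x \<phi>) = lfp (\<lambda>T. sem w (\<rho>(x := T)) \<phi>)"
| "sem w \<rho> (Nu x \<phi>) = gfp (\<lambda>T. sem w (\<rho>(x := T)) \<phi>)"

lemma sem_mono: "\<rho> \<le> \<rho>' \<Longrightarrow> sem w \<rho> \<phi> \<subseteq> sem w \<rho>' \<phi>"
proof (induction \<phi> arbitrary: \<rho> \<rho>')
  case (Var x)
  then show ?case by (auto simp: le_fun_def)
next
  case (Mod m \<phi>)
  from Mod.IH[OF Mod.prems] show ?case by auto
next
  case (Or \<phi> \<psi>)
  from Or.IH(1)[OF Or.prems] Or.IH(2)[OF Or.prems] show ?case by auto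
next
  case (And \<phi> \<psi>)
  from And.IH(1)[OF And.prems] And.IH(2)[OF And.prems] show ?case by auto
next
  case (Mu x \<phi>)
  have "\<rho>(x := T) \<le> \<rho>'(x := T)" for T
    using Mu.prems by (simp add: le_fun_def)
  from Mu.IH[OF this] show ?case unfolding sem.simps by (rule lfp_mono)
next
  case (Nu x \<phi>)
  have "\<rho>(x := T) \<le> \<rho>'(x := T)" for T
    using Nu.prems by (simp add: le_fun_def)
  from Nu.IH[OF this] show ?case unfolding sem.simps by (rule gfp_mono)
qed auto

lemma mono_sem_upd: "mono (\<lambda>T. sem w (\<rho>(x := T)) \<phi>)"
  by (intro monoI sem_mono) (simp add: le_fun_def)

lemma sem_subset_positions: "sem w \<rho> \<phi> \<subseteq> positions w"
proof (induction \<phi> arbitrary: \<rho>)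
  case (Mu x \<phi>)
  show ?case unfolding sem.simps by (rule lfp_lowerbound) (rule Mu.IH)
next
  case (Nu x \<phi>)
  show ?case unfolding sem.simps by (rule gfp_least) (rule order_trans[OF _ Nu.IH])
qed auto

definition equivalent :: "'d itself \<Rightarrow> 'a formula \<Rightarrow> 'a formula \<Rightarrow> bool" where
  "equivalent D \<phi> \<psi> \<longleftrightarrow> (\<forall>(w :: ('a, 'd) data_word) \<rho>. sem w \<rho> \<phi> = sem w \<rho> \<psi>)"

primrec mu_free :: "'a formula \<Rightarrow> bool" where
  "mu_free (Var x) \<longleftrightarrow> True"
| "mu_free (Atom A) \<longleftrightarrow> True"
| "mu_free (NegAtom A) \<longleftrightarrow> True"
| "mu_free (Mod m \<phi>) \<longleftrightarrow> mu_free \<phi>"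
| "mu_free (Or \<phi> \<psi>) \<longleftrightarrow> mu_free \<phi> \<and> mu_free \<psi>"
| "mu_free (And \<phi> \<psi>) \<longleftrightarrow> mu_free \<phi> \<and> mu_free \<psi>"
| "mu_free (Mu x \<phi>) \<longleftrightarrow> False"
| "mu_free (Nu x \<phi>) \<longleftrightarrow> mu_free \<phi>"

definition nu_fragment :: "'a formula set" where
  "nu_fragment = {\<phi>. mu_free \<phi>}"

primrec modalities :: "'a formula \<Rightarrow> modality set" where
  "modalities (Var x) = {}"
| "modalities (Atom A) = {}"
| "modalities (NegAtom A) = {}"
| "modalities (Mod m \<phi>) = insert m (modalities \<phi>)"
| "modalities (Or \<phi> \<psi>) = modalities \<phi> \<union> modalities \<psi>"
| "modalities (And \<phi> \<psi>) = modalities \<phi> \<union> modalities \<psi>"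
| "modalities (Mu x \<phi>) = modalities \<phi>"
| "modalities (Nu x \<phi>) = modalities \<phi>"

definition Formulas :: "modality set \<Rightarrow> 'a formula set" where
  "Formulas M = {\<phi>. modalities \<phi> \<subseteq> M}"

primrec free_vars :: "'a formula \<Rightarrow> nat set" where
  "free_vars (Var x) = {x}"
| "free_vars (Atom A) = {}"
| "free_vars (NegAtom A) = {}"
| "free_vars (Mod m \<phi>) = free_vars \<phi>"
| "free_vars (Or \<phi> \<psi>) = free_vars \<phi> \<union> free_vars \<psi>"
| "free_vars (And \<phi> \<psi>) = free_vars \<phi> \<union> free_vars \<psi>"
| "free_vars (Mu x \<phi>) = free_vars \<phi> - {x}"
| "free_vars (Nu x \<phi>) = free_vars \<phi> - {x}"

text \<open>
  Simultaneous substitution for the free variables. Bound variables are not renamed, so it is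
  capture-avoiding when the substituted formulas are closed. This is always so in \<open>Comp_level\<close>
  below, by lemma \<open>Comp_level_closed\<close>.
\<close>

primrec subst :: "(nat \<Rightarrow> 'a formula) \<Rightarrow> 'a formula \<Rightarrow> 'a formula" where
  "subst \<sigma> (Var x) = \<sigma> x"
| "subst \<sigma> (Atom A) = Atom A"
| "subst \<sigma> (NegAtom A) = NegAtom A"
| "subst \<sigma> (Mod m \<phi>) = Mod m (subst \<sigma> \<phi>)"
| "subst \<sigma> (Or \<phi> \<psi>) = Or (subst \<sigma> \<phi>) (subst \<sigma> \<psi>)"
| "subst \<sigma> (And \<phi> \<psi>) = And (subst \<sigma> \<phi>) (subst \<sigma> \<psi>)"
| "subst \<sigma> (Mu x \<phi>) = Mu x (subst (\<sigma>(x := Var x)) \<phi>)"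
| "subst \<sigma> (Nu x \<phi>) = Nu x (subst (\<sigma>(x := Var x)) \<phi>)"

lemma free_vars_subst_subset:
  "free_vars (subst \<sigma> \<phi>) \<subseteq> (\<Union>x\<in>free_vars \<phi>. free_vars (\<sigma> x))"
proof (induction \<phi> arbitrary: \<sigma>)
  case (Mu x \<phi>)
  have "y \<in> (\<Union>z\<in>free_vars \<phi> - {x}. free_vars (\<sigma> z))"
    if "y \<in> free_vars (subst (\<sigma>(x := Var x)) \<phi>)" "y \<noteq> x" for y
  proof -
    from that(1) Mu.IH obtain z
      where z: "z \<in> free_vars \<phi>" "y \<in> free_vars ((\<sigma>(x := Var x)) z)" by blast
    with that(2) have "z \<noteq> x" by auto
    with z show ?thesis by auto
  qed
  then show ?case unfolding subst.simps free_vars.simps by blast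
next
  case (Nu x \<phi>)
  have "y \<in> (\<Union>z\<in>free_vars \<phi> - {x}. free_vars (\<sigma> z))"
    if "y \<in> free_vars (subst (\<sigma>(x := Var x)) \<phi>)" "y \<noteq> x" for y
  proof -
    from that(1) Nu.IH obtain z
      where z: "z \<in> free_vars \<phi>" "y \<in> free_vars ((\<sigma>(x := Var x)) z)" by blast
    with that(2) have "z \<noteq> x" by auto
    with z show ?thesis by auto
  qed
  then show ?case unfolding subst.simps free_vars.simps by blast
next
  case (Or \<phi> \<psi>)
  from Or.IH[of \<sigma>] show ?case unfolding subst.simps free_vars.simps by blast
next
  case (And \<phi> \<psi>)
  from And.IH[of \<sigma>] show ?case unfolding subst.simps free_vars.simps by blast
qed simp_all

primrec Comp_level :: "nat \<Rightarrow> 'a formula set \<Rightarrow> 'a formula set" where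
  "Comp_level 0 \<Psi> = {}"
| "Comp_level (Suc i) \<Psi> =
     {subst \<sigma> \<psi> | \<sigma> \<psi>. \<psi> \<in> \<Psi> \<and> (\<forall>x \<in> free_vars \<psi>. \<sigma> x \<in> Comp_level i \<Psi>)}"

lemma Comp_level_closed: "\<phi> \<in> Comp_level i \<Psi> \<Longrightarrow> free_vars \<phi> = {}"
proof (induction i arbitrary: \<phi>)
  case (Suc i)
  then obtain \<sigma> \<psi> where "\<phi> = subst \<sigma> \<psi>" "\<forall>x \<in> free_vars \<psi>. \<sigma> x \<in> Comp_level i \<Psi>"
    by auto
  with Suc.IH free_vars_subst_subset[of \<sigma> \<psi>] show ?case by fastforce
qed simp

definition Comp :: "'a formula set \<Rightarrow> 'a formula set" where
  "Comp \<Psi> = (\<Union>i. Comp_level i \<Psi>)"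

definition BR :: "'a formula set" where
  "BR = Comp (Formulas {X_c, X_g} \<union> Formulas {Y_c, Y_g})"

end

theory Submission imports Defs begin

text \<open>
  The forward modalities strictly decrease the distance to the end of the word, and the backward
  ones the distance to its beginning. A fixpoint formula whose variable occurs only below such
  modalities has exactly one fixpoint, so there \<open>\<mu>\<close> and \<open>\<nu>\<close> coincide. To reach this
  situation, write \<open>F\<close> for the operator of \<open>\<mu>x. \<phi>\<close> and let \<open>G\<close> evaluate, at each position
  \<open>i\<close>, the body \<open>\<phi>\<close> with \<open>i\<close> removed from the value of \<open>x\<close>. Minimality gives
  \<open>lfp F \<subseteq> gfp G\<close>, and induction along the modalities gives \<open>gfp G \<subseteq> lfp F\<close>. The operator \<open>G\<close>
  is definable: fix the truth values of variables at the current position, leave subformulas below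
  modalities alone, and unfold each greatest fixpoint once. For BR, this is applied to each layer
  of the composition separately.
\<close>

section \<open>Valuations and substitution\<close>

lemma sem_cong:
  assumes "\<And>x. x \<in> free_vars \<phi> \<Longrightarrow> \<rho> x \<inter> positions w = \<rho>' x \<inter> positions w"
  shows "sem w \<rho> \<phi> = sem w \<rho>' \<phi>"
  using assms
proof (induction \<phi> arbitrary: \<rho> \<rho>')
  case (Or \<phi> \<psi>)
  have "sem w \<rho> \<phi> = sem w \<rho>' \<phi>" "sem w \<rho> \<psi> = sem w \<rho>' \<psi>"
    using Or.prems by (auto intro!: Or.IH)
  then show ?case by simp
next
  case (And \<phi> \<psi>)
  have "sem w \<rho> \<phi> = sem w \<rho>' \<phi>" "sem w \<rho> \<psi> = sem w \<rho>' \<psi>"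
    using And.prems by (auto intro!: And.IH)
  then show ?case by simp
next
  case (Mod m \<phi>)
  have "sem w \<rho> \<phi> = sem w \<rho>' \<phi>"
    using Mod.prems by (intro Mod.IH) simp
  then show ?case by simp
next
  case (Mu x \<phi>)
  have "sem w (\<rho>(x := T)) \<phi> = sem w (\<rho>'(x := T)) \<phi>" for T
    using Mu.prems by (intro Mu.IH) simp
  then show ?case by simp
next
  case (Nu x \<phi>)
  have "sem w (\<rho>(x := T)) \<phi> = sem w (\<rho>'(x := T)) \<phi>" for T
    using Nu.prems by (intro Nu.IH) simp
  then show ?case by simp
qed auto

lemma finite_free_vars: "finite (free_vars \<phi>)"
  by (induction \<phi>) auto

text \<open>The premise covers closed formulas as well as the \<open>Var x\<close> that
  \<open>subst\<close> installs under a binder of \<open>x\<close>. It is therefore preserved under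
  binders, and it excludes capture.\<close>

lemma sem_subst:
  assumes "\<And>x. x \<in> free_vars \<phi> \<Longrightarrow> free_vars (\<sigma> x) \<subseteq> {x}"
  shows "sem w \<rho> (subst \<sigma> \<phi>) = sem w (\<lambda>x. sem w \<rho> (\<sigma> x)) \<phi>"
  using assms
proof (induction \<phi> arbitrary: \<sigma> \<rho>)
  case (Var x)
  then show ?case using sem_subset_positions[of w \<rho> "\<sigma> x"] by auto
next
  case (Mod m \<phi>)
  then have "sem w \<rho> (subst \<sigma> \<phi>) = sem w (\<lambda>x. sem w \<rho> (\<sigma> x)) \<phi>" by simp
  then show ?case by simp
next
  case (Mu x \<phi>)
  have "sem w (\<rho>(x := T)) (subst (\<sigma>(x := Var x)) \<phi>) =
      sem w ((\<lambda>z. sem w \<rho> (\<sigma> z))(x := T)) \<phi>" for T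
  proof -
    have "sem w (\<rho>(x := T)) (subst (\<sigma>(x := Var x)) \<phi>) =
        sem w (\<lambda>z. sem w (\<rho>(x := T)) ((\<sigma>(x := Var x)) z)) \<phi>"
      using Mu.prems by (intro Mu.IH) auto
    also have "\<dots> = sem w ((\<lambda>z. sem w \<rho> (\<sigma> z))(x := T)) \<phi>"
    proof (rule sem_cong)
      fix z assume z: "z \<in> free_vars \<phi>"
      show "sem w (\<rho>(x := T)) ((\<sigma>(x := Var x)) z) \<inter> positions w =
          ((\<lambda>z. sem w \<rho> (\<sigma> z))(x := T)) z \<inter> positions w"
      proof (cases "z = x")
        case False
        have "sem w (\<rho>(x := T)) (\<sigma> z) = sem w \<rho> (\<sigma> z)"
          using Mu.prems[of z] z False by (intro sem_cong) auto
        with False show ?thesis by simp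
      qed simp
    qed
    finally show ?thesis .
  qed
  then show ?case by simp
next
  case (Nu x \<phi>)
  have "sem w (\<rho>(x := T)) (subst (\<sigma>(x := Var x)) \<phi>) =
      sem w ((\<lambda>z. sem w \<rho> (\<sigma> z))(x := T)) \<phi>" for T
  proof -
    have "sem w (\<rho>(x := T)) (subst (\<sigma>(x := Var x)) \<phi>) =
        sem w (\<lambda>z. sem w (\<rho>(x := T)) ((\<sigma>(x := Var x)) z)) \<phi>"
      using Nu.prems by (intro Nu.IH) auto
    also have "\<dots> = sem w ((\<lambda>z. sem w \<rho> (\<sigma> z))(x := T)) \<phi>"
    proof (rule sem_cong)
      fix z assume z: "z \<in> free_vars \<phi>"
      show "sem w (\<rho>(x := T)) ((\<sigma>(x := Var x)) z) \<inter> positions w =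
          ((\<lambda>z. sem w \<rho> (\<sigma> z))(x := T)) z \<inter> positions w"
      proof (cases "z = x")
        case False
        have "sem w (\<rho>(x := T)) (\<sigma> z) = sem w \<rho> (\<sigma> z)"
          using Nu.prems[of z] z False by (intro sem_cong) auto
        with False show ?thesis by simp
      qed simp
    qed
    finally show ?thesis .
  qed
  then show ?case by simp
qed auto

text \<open>The modalities are tracked together with the absence of \<open>Mu\<close>, because the
  translated body of a fixpoint must again be local with respect to the rank.\<close>

definition nu_formulas :: "modality set \<Rightarrow> 'a formula set" where
  "nu_formulas M = {\<phi>. mu_free \<phi> \<and> modalities \<phi> \<subseteq> M}"

lemma nu_formulas_simps [simp]:
  "Var x \<in> nu_formulas M"
  "Atom A \<in> nu_formulas M"
  "NegAtom A \<in> nu_formulas M"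
  "Mod m \<phi> \<in> nu_formulas M \<longleftrightarrow> m \<in> M \<and> \<phi> \<in> nu_formulas M"
  "Or \<phi> \<psi> \<in> nu_formulas M \<longleftrightarrow> \<phi> \<in> nu_formulas M \<and> \<psi> \<in> nu_formulas M"
  "And \<phi> \<psi> \<in> nu_formulas M \<longleftrightarrow> \<phi> \<in> nu_formulas M \<and> \<psi> \<in> nu_formulas M"
  "Mu x \<phi> \<notin> nu_formulas M"
  "Nu x \<phi> \<in> nu_formulas M \<longleftrightarrow> \<phi> \<in> nu_formulas M"
  by (auto simp: nu_formulas_def)

text \<open>
  Unlike \<^const>\<open>subst\<close>, this allows substituted formulas with free variables: bound variables
  are renamed.
\<close>

lemma nu_formulas_subst:
  fixes \<phi> :: "'a formula"
  assumes "\<phi> \<in> nu_formulas M"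
    and "\<And>x. x \<in> free_vars \<phi> \<Longrightarrow> \<sigma> x \<in> nu_formulas M"
  shows "\<exists>\<psi> \<in> nu_formulas M. \<forall>(w :: ('a, 'd) data_word) \<rho>.
    sem w \<rho> \<psi> = sem w (\<lambda>x. sem w \<rho> (\<sigma> x)) \<phi>"
  using assms
proof (induction \<phi> arbitrary: \<sigma>)
  case (Var x)
  have "sem w \<rho> (\<sigma> x) = sem w (\<lambda>x. sem w \<rho> (\<sigma> x)) (Var x)" for w :: "('a, 'd) data_word" and \<rho>
    using sem_subset_positions[of w \<rho> "\<sigma> x"] by auto
  with Var.prems show ?case by auto
next
  case (Atom A)
  show ?case by (rule bexI[of _ "Atom A"]) auto
next
  case (NegAtom A)
  show ?case by (rule bexI[of _ "NegAtom A"]) auto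
next
  case (Mod m \<phi>)
  from Mod.prems Mod.IH[of \<sigma>] obtain \<psi> where "\<psi> \<in> nu_formulas M"
    and "\<forall>(w :: ('a, 'd) data_word) \<rho>. sem w \<rho> \<psi> = sem w (\<lambda>x. sem w \<rho> (\<sigma> x)) \<phi>" by auto
  with Mod.prems show ?case by (intro bexI[of _ "Mod m \<psi>"]) auto
next
  case (Or \<phi>1 \<phi>2)
  from Or.prems Or.IH(1)[of \<sigma>] obtain \<psi>1 where "\<psi>1 \<in> nu_formulas M"
    and "\<forall>(w :: ('a, 'd) data_word) \<rho>. sem w \<rho> \<psi>1 = sem w (\<lambda>x. sem w \<rho> (\<sigma> x)) \<phi>1" by auto
  moreover from Or.prems Or.IH(2)[of \<sigma>] obtain \<psi>2 where "\<psi>2 \<in> nu_formulas M"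
    and "\<forall>(w :: ('a, 'd) data_word) \<rho>. sem w \<rho> \<psi>2 = sem w (\<lambda>x. sem w \<rho> (\<sigma> x)) \<phi>2" by auto
  ultimately show ?case by (intro bexI[of _ "Or \<psi>1 \<psi>2"]) auto
next
  case (And \<phi>1 \<phi>2)
  from And.prems And.IH(1)[of \<sigma>] obtain \<psi>1 where "\<psi>1 \<in> nu_formulas M"
    and "\<forall>(w :: ('a, 'd) data_word) \<rho>. sem w \<rho> \<psi>1 = sem w (\<lambda>x. sem w \<rho> (\<sigma> x)) \<phi>1" by auto
  moreover from And.prems And.IH(2)[of \<sigma>] obtain \<psi>2 where "\<psi>2 \<in> nu_formulas M"
    and "\<forall>(w :: ('a, 'd) data_word) \<rho>. sem w \<rho> \<psi>2 = sem w (\<lambda>x. sem w \<rho> (\<sigma> x)) \<phi>2" by auto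
  ultimately show ?case by (intro bexI[of _ "And \<psi>1 \<psi>2"]) auto
next
  case (Mu x \<phi>)
  then show ?case by simp
next
  case (Nu x \<phi>)
  \<comment> \<open>The fresh \<open>y\<close> becomes the new bound variable; the induction
    hypothesis is used with \<open>x\<close> sent to \<open>Var y\<close>.\<close>
  have "finite (\<Union>z\<in>free_vars \<phi>. free_vars (\<sigma> z))"
    by (simp add: finite_free_vars)
  then obtain y where y: "y \<notin> (\<Union>z\<in>free_vars \<phi>. free_vars (\<sigma> z))"
    using ex_new_if_finite infinite_UNIV_nat by blast
  have "\<exists>\<psi> \<in> nu_formulas M. \<forall>(w :: ('a, 'd) data_word) \<rho>.
      sem w \<rho> \<psi> = sem w (\<lambda>z. sem w \<rho> ((\<sigma>(x := Var y)) z)) \<phi>"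
    using Nu.prems by (intro Nu.IH) auto
  then obtain \<psi> where \<psi>: "\<psi> \<in> nu_formulas M"
    and sem_\<psi>: "\<And>(w :: ('a, 'd) data_word) \<rho>.
      sem w \<rho> \<psi> = sem w (\<lambda>z. sem w \<rho> ((\<sigma>(x := Var y)) z)) \<phi>" by blast
  have "sem w (\<rho>(y := T)) \<psi> = sem w ((\<lambda>z. sem w \<rho> (\<sigma> z))(x := T)) \<phi>"
    for w :: "('a, 'd) data_word" and \<rho> T
    unfolding sem_\<psi>
  proof (rule sem_cong)
    fix z assume z: "z \<in> free_vars \<phi>"
    show "sem w (\<rho>(y := T)) ((\<sigma>(x := Var y)) z) \<inter> positions w =
        ((\<lambda>z. sem w \<rho> (\<sigma> z))(x := T)) z \<inter> positions w"
    proof (cases "z = x")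
      case False
      have "sem w (\<rho>(y := T)) (\<sigma> z) = sem w \<rho> (\<sigma> z)"
        using y z by (intro sem_cong) auto
      with False show ?thesis by simp
    qed simp
  qed
  with \<psi> show ?case by (intro bexI[of _ "Nu y \<psi>"]) auto
qed

section \<open>Eliminating least fixpoints in one direction\<close>

text \<open>The partial map \<open>a\<close> serves nested fixpoints: \<open>Some False\<close> for
  the variable of the least fixpoint being eliminated, \<open>Some True\<close> for greatest
  fixpoints entered on the way down, \<open>None\<close> for variables left alone.\<close>

definition update_at :: "(nat \<Rightarrow> bool option) \<Rightarrow> nat \<Rightarrow> (nat \<Rightarrow> nat set) \<Rightarrow> nat \<Rightarrow> nat set" where
  "update_at a i \<rho> x =
     (case a x of None \<Rightarrow> \<rho> x | Some b \<Rightarrow> if b then insert i (\<rho> x) else \<rho> x - {i})"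

lemma mem_update_at: "j \<noteq> i \<Longrightarrow> j \<in> update_at a i \<rho> x \<longleftrightarrow> j \<in> \<rho> x"
  by (auto simp: update_at_def split: option.splits)

lemma update_at_fun_upd:
  "update_at (a(z := Some True)) i (\<rho>(z := V)) = (update_at a i \<rho>)(z := insert i V)"
  by (auto simp: fun_eq_iff update_at_def split: option.split)

text \<open>Treats both directions at once; all that matters is that each modal step lowers a
  number.\<close>

locale ranked_modalities =
  fixes M :: "modality set"
    and rank :: "('a, 'd) data_word \<Rightarrow> nat \<Rightarrow> nat"
  assumes rank_less: "m \<in> M \<Longrightarrow> mod_step m w i j \<Longrightarrow> rank w j < rank w i"
begin

text \<open>Evaluation moves only along modal steps, so it never leaves a set closed under them. For
  \<open>Nu\<close>, the fixpoint cut down to \<open>U\<close> is a post-fixpoint under the other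
  valuation, and coinduction applies.\<close>

lemma sem_local:
  assumes "\<phi> \<in> nu_formulas M"
    and closed: "\<And>m i j. m \<in> M \<Longrightarrow> mod_step m w i j \<Longrightarrow> i \<in> U \<Longrightarrow> j \<in> U"
    and "\<And>x. \<rho> x \<inter> U = \<rho>' x \<inter> U"
  shows "sem w \<rho> \<phi> \<inter> U = sem w \<rho>' \<phi> \<inter> U"
  using assms(1,3)
proof (induction \<phi> arbitrary: \<rho> \<rho>')
  case (Mod m \<phi>)
  from Mod.prems have "sem w \<rho> \<phi> \<inter> U = sem w \<rho>' \<phi> \<inter> U" by (intro Mod.IH) auto
  with closed[of m] Mod.prems(1) show ?case by auto
next
  case (Or \<phi> \<psi>)
  from Or.prems have "sem w \<rho> \<phi> \<inter> U = sem w \<rho>' \<phi> \<inter> U" "sem w \<rho> \<psi> \<inter> U = sem w \<rho>' \<psi> \<inter> U"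
    by (auto intro!: Or.IH)
  then show ?case by auto
next
  case (And \<phi> \<psi>)
  from And.prems have "sem w \<rho> \<phi> \<inter> U = sem w \<rho>' \<phi> \<inter> U" "sem w \<rho> \<psi> \<inter> U = sem w \<rho>' \<psi> \<inter> U"
    by (auto intro!: And.IH)
  then show ?case by auto
next
  case (Nu x \<phi>)
  have sub: "gfp (\<lambda>T. sem w (\<rho>(x := T)) \<phi>) \<inter> U \<subseteq> gfp (\<lambda>T. sem w (\<rho>'(x := T)) \<phi>)"
    if "\<And>x. \<rho> x \<inter> U = \<rho>' x \<inter> U" for \<rho> \<rho>'
  proof (rule gfp_upperbound)
    let ?V = "gfp (\<lambda>T. sem w (\<rho>(x := T)) \<phi>)"
    have "?V = sem w (\<rho>(x := ?V)) \<phi>"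
      by (rule gfp_unfold[OF mono_sem_upd])
    moreover have "sem w (\<rho>(x := ?V)) \<phi> \<inter> U = sem w (\<rho>'(x := ?V \<inter> U)) \<phi> \<inter> U"
      using Nu.prems(1) that by (intro Nu.IH) auto
    ultimately show "?V \<inter> U \<subseteq> sem w (\<rho>'(x := ?V \<inter> U)) \<phi>" by blast
  qed
  have eq: "\<rho> x \<inter> U = \<rho>' x \<inter> U" for x by (rule Nu.prems(2))
  show ?case
    unfolding sem.simps using sub[of \<rho> \<rho>', OF eq] sub[of \<rho>' \<rho>, OF eq[symmetric]] by blast
qed auto

lemma sem_local_below:
  assumes "\<phi> \<in> nu_formulas M"
    and "\<And>x j. rank w j < n \<Longrightarrow> j \<in> \<rho> x \<longleftrightarrow> j \<in> \<rho>' x"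
    and "rank w i < n"
  shows "i \<in> sem w \<rho> \<phi> \<longleftrightarrow> i \<in> sem w \<rho>' \<phi>"
proof -
  have "sem w \<rho> \<phi> \<inter> {j. rank w j < n} = sem w \<rho>' \<phi> \<inter> {j. rank w j < n}"
    using assms(1) by (rule sem_local) (use assms(2) in \<open>auto dest: rank_less\<close>)
  with assms(3) show ?thesis by blast
qed

text \<open>Adding just \<open>i\<close> to the lower ranks keeps the set closed, as every step from
  \<open>i\<close> drops in rank. Once \<open>i\<close> is removed from a value, only lower ranks
  count; \<open>Mu_eq_Nu\<close> relies on this.\<close>

lemma sem_local_at:
  assumes "\<phi> \<in> nu_formulas M"
    and "\<And>x j. j = i \<or> rank w j < rank w i \<Longrightarrow> j \<in> \<rho> x \<longleftrightarrow> j \<in> \<rho>' x"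
  shows "i \<in> sem w \<rho> \<phi> \<longleftrightarrow> i \<in> sem w \<rho>' \<phi>"
proof -
  let ?U = "{j. j = i \<or> rank w j < rank w i}"
  have "sem w \<rho> \<phi> \<inter> ?U = sem w \<rho>' \<phi> \<inter> ?U"
    using assms(1) by (rule sem_local) (use assms(2) in \<open>auto dest: rank_less\<close>)
  then show ?thesis by blast
qed

lemma nu_formulas_update_at:
  assumes "\<phi> \<in> nu_formulas M"
  shows "\<exists>\<psi> \<in> nu_formulas M. \<forall>(w :: ('a, 'd) data_word) \<rho>. \<forall>i \<in> positions w.
    i \<in> sem w \<rho> \<psi> \<longleftrightarrow> i \<in> sem w (update_at a i \<rho>) \<phi>"
  using assms
proof (induction \<phi> arbitrary: a)
  case (Var x)
  show ?case
  proof (cases "a x")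
    case None
    then show ?thesis by (intro bexI[of _ "Var x"]) (auto simp: update_at_def)
  next
    case (Some b)
    \<comment> \<open>The syntax has no truth constants, so they are built from an arbitrarily
      chosen atom.\<close>
    then show ?thesis
      by (intro bexI[of _ "if b then Or (Atom S) (NegAtom S) else And (Atom S) (NegAtom S)"])
        (auto simp: update_at_def)
  qed
next
  case (Atom A)
  show ?case by (rule bexI[of _ "Atom A"]) auto
next
  case (NegAtom A)
  show ?case by (rule bexI[of _ "NegAtom A"]) auto
next
  case (Mod m \<phi>)
  \<comment> \<open>After a modal step the rank is below that of \<open>i\<close>, where a change at
    \<open>i\<close> is invisible. Hence the formula is its own witness.\<close>
  have "j \<in> sem w \<rho> \<phi> \<longleftrightarrow> j \<in> sem w (update_at a i \<rho>) \<phi>"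
    if "mod_step m w i j" for w :: "('a, 'd) data_word" and i j \<rho>
  proof (rule sem_local_below)
    show "rank w j < rank w i" using rank_less[OF _ that] Mod.prems by simp
    show "k \<in> \<rho> x \<longleftrightarrow> k \<in> update_at a i \<rho> x" if "rank w k < rank w i" for x k
      using that mem_update_at[of k i a \<rho> x] by auto
  qed (use Mod.prems in simp)
  then have "i \<in> sem w \<rho> (Mod m \<phi>) \<longleftrightarrow> i \<in> sem w (update_at a i \<rho>) (Mod m \<phi>)"
    for w :: "('a, 'd) data_word" and \<rho> i
    unfolding sem.simps by blast
  with Mod.prems show ?case by blast
next
  case (Or \<phi>1 \<phi>2)
  from Or.prems Or.IH(1)[of a] obtain \<psi>1 where "\<psi>1 \<in> nu_formulas M"
    and "\<forall>(w :: ('a, 'd) data_word) \<rho>. \<forall>i \<in> positions w.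
      i \<in> sem w \<rho> \<psi>1 \<longleftrightarrow> i \<in> sem w (update_at a i \<rho>) \<phi>1" by auto
  moreover from Or.prems Or.IH(2)[of a] obtain \<psi>2 where "\<psi>2 \<in> nu_formulas M"
    and "\<forall>(w :: ('a, 'd) data_word) \<rho>. \<forall>i \<in> positions w.
      i \<in> sem w \<rho> \<psi>2 \<longleftrightarrow> i \<in> sem w (update_at a i \<rho>) \<phi>2" by auto
  ultimately show ?case by (intro bexI[of _ "Or \<psi>1 \<psi>2"]) auto
next
  case (And \<phi>1 \<phi>2)
  from And.prems And.IH(1)[of a] obtain \<psi>1 where "\<psi>1 \<in> nu_formulas M"
    and "\<forall>(w :: ('a, 'd) data_word) \<rho>. \<forall>i \<in> positions w.
      i \<in> sem w \<rho> \<psi>1 \<longleftrightarrow> i \<in> sem w (update_at a i \<rho>) \<phi>1" by auto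
  moreover from And.prems And.IH(2)[of a] obtain \<psi>2 where "\<psi>2 \<in> nu_formulas M"
    and "\<forall>(w :: ('a, 'd) data_word) \<rho>. \<forall>i \<in> positions w.
      i \<in> sem w \<rho> \<psi>2 \<longleftrightarrow> i \<in> sem w (update_at a i \<rho>) \<phi>2" by auto
  ultimately show ?case by (intro bexI[of _ "And \<psi>1 \<psi>2"]) auto
next
  case (Mu x \<phi>)
  then show ?case by simp
next
  case (Nu z \<phi>)
  from Nu.prems have "\<phi> \<in> nu_formulas M" by simp
  \<comment> \<open>A position lies in a greatest fixpoint iff the body holds there assuming that it
    does, hence the value \<open>True\<close> for \<open>z\<close>.\<close>
  from Nu.IH[OF this, of "a(z := Some True)"] obtain \<psi> where \<psi>: "\<psi> \<in> nu_formulas M"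
    and sem_\<psi>: "\<And>(w :: ('a, 'd) data_word) \<rho> i. i \<in> positions w \<Longrightarrow>
      i \<in> sem w \<rho> \<psi> \<longleftrightarrow> i \<in> sem w (update_at (a(z := Some True)) i \<rho>) \<phi>" by blast
  \<comment> \<open>The one unfolding: \<open>z\<close> becomes \<open>Nu z \<phi>\<close> under the
    unchanged valuation. Since \<open>i\<close> itself is inserted by the update, only its values at
    lower ranks matter, and there it agrees with the fixpoint for the changed valuation.\<close>
  have "\<exists>\<chi> \<in> nu_formulas M. \<forall>(w :: ('a, 'd) data_word) \<rho>.
      sem w \<rho> \<chi> = sem w (\<lambda>x. sem w \<rho> ((Var(z := Nu z \<phi>)) x)) \<psi>"
    using \<psi> by (rule nu_formulas_subst) (use Nu.prems in simp)
  then obtain \<chi> where \<chi>: "\<chi> \<in> nu_formulas M"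
    and sem_\<chi>: "\<And>(w :: ('a, 'd) data_word) \<rho>.
      sem w \<rho> \<chi> = sem w (\<lambda>x. sem w \<rho> ((Var(z := Nu z \<phi>)) x)) \<psi>" by blast
  have "i \<in> sem w \<rho> \<chi> \<longleftrightarrow> i \<in> sem w (update_at a i \<rho>) (Nu z \<phi>)"
    if i: "i \<in> positions w" for w :: "('a, 'd) data_word" and \<rho> i
  proof -
    define \<rho>' where "\<rho>' = update_at a i \<rho>"
    define V where "V = sem w \<rho> (Nu z \<phi>)"
    define V' where "V' = sem w \<rho>' (Nu z \<phi>)"
    have V'_fix: "V' = sem w (\<rho>'(z := V')) \<phi>"
      unfolding V'_def sem.simps by (rule gfp_unfold[OF mono_sem_upd])
    have V'_sub: "V' \<subseteq> sem w (\<rho>'(z := insert i V')) \<phi>"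
      by (subst V'_fix, rule sem_mono) (auto simp: le_fun_def)
    have "sem w \<rho> \<chi> = sem w (\<rho>(z := V)) \<psi>"
      unfolding sem_\<chi> V_def by (rule sem_cong) auto
    then have "i \<in> sem w \<rho> \<chi> \<longleftrightarrow> i \<in> sem w (\<rho>'(z := insert i V)) \<phi>"
      using sem_\<psi>[OF i, of "\<rho>(z := V)"] by (simp add: update_at_fun_upd \<rho>'_def)
    also have "\<dots> \<longleftrightarrow> i \<in> sem w (\<rho>'(z := insert i V')) \<phi>"
    proof (rule sem_local_at)
      have "j \<in> V \<longleftrightarrow> j \<in> V'" if "rank w j < rank w i" for j
        unfolding V_def V'_def
      proof (rule sem_local_below[OF Nu.prems _ that])
        show "k \<in> \<rho> x \<longleftrightarrow> k \<in> \<rho>' x" if "rank w k < rank w i" for x k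
          using that mem_update_at[of k i a \<rho> x] by (auto simp: \<rho>'_def)
      qed
      then show "j \<in> (\<rho>'(z := insert i V)) x \<longleftrightarrow> j \<in> (\<rho>'(z := insert i V')) x"
        if "j = i \<or> rank w j < rank w i" for x j
        using that by auto
    qed (use Nu.prems in simp)
    \<comment> \<open>Coinduction: if the body holds at \<open>i\<close> once \<open>i\<close> is
      assumed, then \<open>insert i V'\<close> is a post-fixpoint.\<close>
    also have "\<dots> \<longleftrightarrow> i \<in> V'"
    proof
      assume "i \<in> sem w (\<rho>'(z := insert i V')) \<phi>"
      with V'_sub have "insert i V' \<subseteq> sem w (\<rho>'(z := insert i V')) \<phi>" by simp
      then have "insert i V' \<subseteq> V'"
        unfolding V'_def sem.simps by (rule gfp_upperbound)
      then show "i \<in> V'" by simp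
    qed (use V'_sub in blast)
    finally show ?thesis by (simp add: V'_def \<rho>'_def)
  qed
  with \<chi> show ?case by blast
qed

text \<open>With \<open>i\<close> removed, the truth of \<open>\<psi>\<close> at \<open>i\<close>
  rests on lower ranks alone, so the greatest fixpoint admits no position that supports
  itself.\<close>

lemma Mu_eq_Nu:
  fixes w :: "('a, 'd) data_word"
  assumes \<phi>: "\<phi> \<in> nu_formulas M"
    and \<psi>: "\<And>T i. i \<in> positions w \<Longrightarrow>
      i \<in> sem w (\<rho>(x := T)) \<psi> \<longleftrightarrow> i \<in> sem w (\<rho>(x := T - {i})) \<phi>"
  shows "sem w \<rho> (Mu x \<phi>) = sem w \<rho> (Nu x \<psi>)"
proof
  let ?F = "\<lambda>T. sem w (\<rho>(x := T)) \<phi>" and ?G = "\<lambda>T. sem w (\<rho>(x := T)) \<psi>"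
  let ?L = "lfp ?F" and ?V = "gfp ?G"
  have L: "?L = ?F ?L" by (rule lfp_unfold[OF mono_sem_upd])
  have V: "?V = ?G ?V" by (rule gfp_unfold[OF mono_sem_upd])
  have "?L \<subseteq> ?G ?L"
  proof
    fix i assume i: "i \<in> ?L"
    then have pos: "i \<in> positions w"
      using L sem_subset_positions by blast
    \<comment> \<open>Otherwise \<open>?L - {i}\<close> would be a pre-fixpoint strictly below the
      least one.\<close>
    have "i \<in> ?F (?L - {i})"
    proof (rule ccontr)
      assume "i \<notin> ?F (?L - {i})"
      moreover have "?F (?L - {i}) \<subseteq> ?L"
        by (subst (2) L) (rule monoD[OF mono_sem_upd], blast)
      ultimately have "?F (?L - {i}) \<subseteq> ?L - {i}" by blast
      then have "?L \<subseteq> ?L - {i}" by (rule lfp_lowerbound)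
      with i show False by blast
    qed
    then show "i \<in> ?G ?L" using \<psi>[OF pos] by blast
  qed
  then show "sem w \<rho> (Mu x \<phi>) \<subseteq> sem w \<rho> (Nu x \<psi>)"
    unfolding sem.simps by (rule gfp_upperbound)
  have "i \<in> ?V \<Longrightarrow> i \<in> ?L" for i
  proof (induction "rank w i" arbitrary: i rule: less_induct)
    case less
    let ?U = "{j. j = i \<or> rank w j < rank w i}"
    from less.prems V have i: "i \<in> ?G ?V" by blast
    then have "i \<in> ?F (?V - {i})"
      using \<psi> sem_subset_positions by blast
    \<comment> \<open>By locality the value may be restricted to \<open>?U\<close>; without
      \<open>i\<close>, what remains has lower rank and lies in \<open>?L\<close> by
      induction.\<close>
    also have "i \<in> ?F (?V - {i}) \<longleftrightarrow> i \<in> ?F ((?V - {i}) \<inter> ?U)"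
      by (rule sem_local_at[OF \<phi>]) auto
    finally have "i \<in> ?F ((?V - {i}) \<inter> ?U)" .
    moreover have "?F ((?V - {i}) \<inter> ?U) \<subseteq> ?F ?L"
      by (rule monoD[OF mono_sem_upd]) (use less.hyps in blast)
    ultimately show ?case using L by blast
  qed
  then show "sem w \<rho> (Nu x \<psi>) \<subseteq> sem w \<rho> (Mu x \<phi>)"
    unfolding sem.simps by blast
qed

text \<open>Least fixpoints are eliminated from the inside out, so that the body is already free of
  \<open>Mu\<close>, as locality requires, when its own binder is treated.\<close>

lemma Formulas_equivalent_nu:
  fixes \<phi> :: "'a formula"
  assumes "\<phi> \<in> Formulas M"
  shows "\<exists>\<psi> \<in> nu_formulas M. equivalent TYPE('d) \<phi> \<psi>"
  using assms
proof (induction \<phi>)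
  case (Var x)
  show ?case by (rule bexI[of _ "Var x"]) (auto simp: equivalent_def)
next
  case (Atom A)
  show ?case by (rule bexI[of _ "Atom A"]) (auto simp: equivalent_def)
next
  case (NegAtom A)
  show ?case by (rule bexI[of _ "NegAtom A"]) (auto simp: equivalent_def)
next
  case (Mod m \<phi>)
  then obtain \<psi> where "\<psi> \<in> nu_formulas M" "equivalent TYPE('d) \<phi> \<psi>"
    by (auto simp: Formulas_def)
  with Mod.prems show ?case
    by (intro bexI[of _ "Mod m \<psi>"]) (auto simp: equivalent_def Formulas_def)
next
  case (Or \<phi>1 \<phi>2)
  then obtain \<psi>1 \<psi>2 where "\<psi>1 \<in> nu_formulas M" "equivalent TYPE('d) \<phi>1 \<psi>1"
    "\<psi>2 \<in> nu_formulas M" "equivalent TYPE('d) \<phi>2 \<psi>2"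
    by (auto simp: Formulas_def)
  then show ?case by (intro bexI[of _ "Or \<psi>1 \<psi>2"]) (auto simp: equivalent_def)
next
  case (And \<phi>1 \<phi>2)
  then obtain \<psi>1 \<psi>2 where "\<psi>1 \<in> nu_formulas M" "equivalent TYPE('d) \<phi>1 \<psi>1"
    "\<psi>2 \<in> nu_formulas M" "equivalent TYPE('d) \<phi>2 \<psi>2"
    by (auto simp: Formulas_def)
  then show ?case by (intro bexI[of _ "And \<psi>1 \<psi>2"]) (auto simp: equivalent_def)
next
  case (Nu x \<phi>)
  then obtain \<psi> where "\<psi> \<in> nu_formulas M" "equivalent TYPE('d) \<phi> \<psi>"
    by (auto simp: Formulas_def)
  then show ?case by (intro bexI[of _ "Nu x \<psi>"]) (auto simp: equivalent_def)
next
  case (Mu x \<phi>)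
  then obtain \<phi>' where \<phi>': "\<phi>' \<in> nu_formulas M" "equivalent TYPE('d) \<phi> \<phi>'"
    by (auto simp: Formulas_def)
  from nu_formulas_update_at[OF \<phi>'(1), of "[x \<mapsto> False]"]
  obtain \<psi> where \<psi>: "\<psi> \<in> nu_formulas M"
    and sem_\<psi>: "\<And>(w :: ('a, 'd) data_word) \<rho> i. i \<in> positions w \<Longrightarrow>
      i \<in> sem w \<rho> \<psi> \<longleftrightarrow> i \<in> sem w (update_at [x \<mapsto> False] i \<rho>) \<phi>'" by blast
  have upd: "update_at [x \<mapsto> False] i (\<rho>(x := T)) = \<rho>(x := T - {i})" for i \<rho> T
    by (auto simp: fun_eq_iff update_at_def)
  have "sem w \<rho> (Mu x \<phi>) = sem w \<rho> (Nu x \<psi>)" for w :: "('a, 'd) data_word" and \<rho>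
  proof -
    have "sem w \<rho> (Mu x \<phi>) = sem w \<rho> (Mu x \<phi>')"
      using \<phi>'(2) by (simp add: equivalent_def)
    also have "\<dots> = sem w \<rho> (Nu x \<psi>)"
      by (rule Mu_eq_Nu[OF \<phi>'(1)]) (simp add: sem_\<psi> upd)
    finally show ?thesis .
  qed
  with \<psi> show ?case
    unfolding equivalent_def by (intro bexI[of _ "Nu x \<psi>"]) simp_all
qed

end

section \<open>The two directions and their composition\<close>

interpretation forward: ranked_modalities "{X_c, X_g}"
  "(\<lambda>w i. length w - i) :: ('a, 'd) data_word \<Rightarrow> nat \<Rightarrow> nat"
  \<comment> \<open>The target of a step is a position of the word, so the truncated subtraction
    does decrease strictly.\<close>
  by standard (auto simp: is_succ_def is_class_succ_def same_class_def positions_def)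

interpretation backward: ranked_modalities "{Y_c, Y_g}"
  "(\<lambda>w i. i) :: ('a, 'd) data_word \<Rightarrow> nat \<Rightarrow> nat"
  by standard (auto simp: is_pred_def is_class_pred_def)

text \<open>Layers may alternate in direction, so no single rank fits the composed formula. Each
  layer is translated with its variables as parameters, which is possible because equivalence ranges
  over all valuations; only the absence of \<open>Mu\<close> has to survive.\<close>

lemma Comp_level_equivalent_nu:
  fixes \<phi> :: "'a formula"
  assumes \<Psi>: "\<And>\<psi>. \<psi> \<in> \<Psi> \<Longrightarrow> \<exists>\<psi>' \<in> nu_formulas UNIV. equivalent TYPE('d) \<psi> \<psi>'"
    and "\<phi> \<in> Comp_level n \<Psi>"
  shows "\<exists>\<psi> \<in> nu_formulas UNIV. equivalent TYPE('d) \<phi> \<psi>"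
  using assms(2)
proof (induction n arbitrary: \<phi>)
  case (Suc n)
  then obtain \<sigma> \<psi> where \<phi>: "\<phi> = subst \<sigma> \<psi>" and \<psi>: "\<psi> \<in> \<Psi>"
    and \<sigma>: "\<And>x. x \<in> free_vars \<psi> \<Longrightarrow> \<sigma> x \<in> Comp_level n \<Psi>" by auto
  from \<Psi>[OF \<psi>] obtain \<psi>' where \<psi>': "\<psi>' \<in> nu_formulas UNIV" "equivalent TYPE('d) \<psi> \<psi>'" by blast
  \<comment> \<open>The choice is total because equivalence does not bound the free variables of
    \<open>\<psi>'\<close> by those of \<open>\<psi>\<close>; elsewhere a plain variable serves as
    default.\<close>
  have "\<exists>\<sigma>'. \<forall>x. \<sigma>' x \<in> nu_formulas UNIV \<and>
      (x \<in> free_vars \<psi> \<longrightarrow> equivalent TYPE('d) (\<sigma> x) (\<sigma>' x))"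
  proof (rule choice, rule allI)
    fix x
    show "\<exists>\<chi>. \<chi> \<in> nu_formulas UNIV \<and> (x \<in> free_vars \<psi> \<longrightarrow> equivalent TYPE('d) (\<sigma> x) \<chi>)"
      using Suc.IH[OF \<sigma>, of x] nu_formulas_simps(1) by blast
  qed
  then obtain \<sigma>' where \<sigma>': "\<And>x. \<sigma>' x \<in> nu_formulas UNIV"
    and equiv: "\<And>x. x \<in> free_vars \<psi> \<Longrightarrow> equivalent TYPE('d) (\<sigma> x) (\<sigma>' x)" by blast
  \<comment> \<open>The formulas \<open>\<sigma>' x\<close> are not known to be closed, so the
    substitution that renames bound variables is used.\<close>
  have "\<exists>\<chi> \<in> nu_formulas UNIV. \<forall>(w :: ('a, 'd) data_word) \<rho>.
      sem w \<rho> \<chi> = sem w (\<lambda>x. sem w \<rho> (\<sigma>' x)) \<psi>'"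
    using \<psi>'(1) \<sigma>' by (rule nu_formulas_subst)
  then obtain \<chi> where \<chi>: "\<chi> \<in> nu_formulas UNIV"
    and sem_\<chi>: "\<And>(w :: ('a, 'd) data_word) \<rho>.
      sem w \<rho> \<chi> = sem w (\<lambda>x. sem w \<rho> (\<sigma>' x)) \<psi>'" by blast
  have "sem w \<rho> \<phi> = sem w \<rho> \<chi>" for w :: "('a, 'd) data_word" and \<rho>
  proof -
    have "sem w \<rho> \<phi> = sem w (\<lambda>x. sem w \<rho> (\<sigma> x)) \<psi>"
      unfolding \<phi> using Comp_level_closed[OF \<sigma>] by (intro sem_subst) blast
    also have "\<dots> = sem w (\<lambda>x. sem w \<rho> (\<sigma>' x)) \<psi>"
      using equiv by (intro sem_cong) (auto simp: equivalent_def)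
    also have "\<dots> = sem w \<rho> \<chi>"
      using \<psi>'(2) by (simp add: sem_\<chi> equivalent_def)
    finally show ?thesis .
  qed
  with \<chi> show ?case by (auto simp: equivalent_def)
qed simp

theorem theorem6:
  fixes \<phi> :: "'a::finite formula"
  assumes "infinite (UNIV :: 'd set)"
    and "\<phi> \<in> BR"
  shows "\<exists>\<psi> \<in> nu_fragment. equivalent TYPE('d) \<phi> \<psi>"
proof -
  have "\<exists>\<psi>' \<in> nu_formulas UNIV. equivalent TYPE('d) \<psi> \<psi>'"
    if "\<psi> \<in> Formulas {X_c, X_g} \<union> Formulas {Y_c, Y_g}" for \<psi> :: "'a formula"
    using that forward.Formulas_equivalent_nu[of \<psi>] backward.Formulas_equivalent_nu[of \<psi>]
    by (auto simp: nu_formulas_def)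
  moreover from assms(2) obtain n
    where "\<phi> \<in> Comp_level n (Formulas {X_c, X_g} \<union> Formulas {Y_c, Y_g})"
    by (auto simp: BR_def Comp_def)
  ultimately have "\<exists>\<psi> \<in> nu_formulas UNIV. equivalent TYPE('d) \<phi> \<psi>"
    by (rule Comp_level_equivalent_nu)
  then show ?thesis by (auto simp: nu_formulas_def nu_fragment_def)
qed

end
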